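(* Let $G=E_6$ be the simply connected compact Lie group of type $E_6$, let $m$ be a positive integer and $p$ a prime. Write $m=p^i m'$ with $p\nmid m'$. Consider the conditions $$b_2>\dots>b_5>|b_6|,\quad \sqrt3\,b_1>b_2+\dots+b_5-b_6,\quad p^i>\tfrac12(\sqrt3\,b_1+b_2+\dots+b_6),\quad 2\mid(\sqrt3\,b_1+b_2+\dots+b_6)\qquad( * )$$ on a tuple of real numbers $(b_1,\dots,b_6)$. (1) If $p=3$, then $N(E_6,m,3)$ is the number of tuples $$(b_1,\dots,b_6)\in\left(\tfrac{1}{\sqrt3}\mathbb{Z}\times\mathbb{Z}^5\right)\cup\left(\tfrac{1}{\sqrt3}(\mathbb{Z}+\tfrac12)\times(\mathbb{Z}+\tfrac12)^5\right)$$ satisfying $( * )$. (2) If $p\ne3$, then $N(E_6,m,p)$ is the number of tuples $$(b_1,\dots,b_6)\in\left(\sqrt3\,\mathbb{Z}\times\mathbb{Z}^5\right)\cup\left(\sqrt3(\mathbb{Z}+\tfrac12)\times(\mathbb{Z}+\tfrac12)^5\right)$$ satisfying $( * )$.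
   Context: Let $G$ be a simply connected simple compact Lie group with maximal torus $T$ and weight lattice $\Pi^*=\mathrm{Hom}(T,S^1)$. $\langle\cdot,\cdot\rangle$ is the unique Weyl-invariant inner product on $\Pi^*$ (extended to $\Pi^*\otimes\mathbb{R}$) with $\langle u,u\rangle=2$ for all long roots $u$ (in the simply laced case all roots are long). The fundamental Weyl chamber $V\subset\Pi^*\otimes\mathbb{R}$ is the set of points having non-negative inner product with all positive roots; $\theta$ is the highest root. The level $m$ fundamental alcove is $A=\{x\in V:\langle\theta,x\rangle\le m\}$. A level $m$ regular weight is an element of $\Pi^*$ in the interior of $A$. $N(G,m,p)$ denotes the number of level $m$ regular weights $a$ such that for every weight $w\in\Pi^*$ the denominator (in lowest terms) of the rational number $\langle w,a\rangle/m$ is a power $p^k$, $k\ge0$, of $p$. *)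

theory Defs
  imports
    "HOL-Analysis.Analysis"
    "HOL-Computational_Algebra.Group_Closure"
    "HOL-Computational_Algebra.Primes"
begin

text \<open>
  Compact Lie groups are not available in the libraries. A simple compact Lie group with a maximal
  torus \<open>T\<close> enters here through its root datum: the type \<open>'a\<close> is the real vector space
  \<open>\<Pi>\<^sup>* \<otimes> \<real>\<close> spanned by the characters of \<open>T\<close>, with a Weyl-invariant inner product; \<open>L\<close> is the
  character lattice \<open>\<Pi>\<^sup>* = Hom(T, S\<^sup>1)\<close>; and \<open>\<Phi>\<close> is the set of roots.
\<close>

definition reflect :: "'a::euclidean_space \<Rightarrow> 'a \<Rightarrow> 'a" where
  "reflect \<alpha> x = x - (2 * (x \<bullet> \<alpha>) / (\<alpha> \<bullet> \<alpha>)) *\<^sub>R \<alpha>"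

text \<open>Coroots and cocharacters are regarded as elements of \<open>'a\<close> by means of the inner product.\<close>

definition coroot :: "'a::euclidean_space \<Rightarrow> 'a" where
  "coroot \<alpha> = (2 / (\<alpha> \<bullet> \<alpha>)) *\<^sub>R \<alpha>"

text \<open>Reduced crystallographic root systems. Closure under the orthogonal reflections makes the
  inner product Weyl-invariant.\<close>

definition root_system :: "'a::euclidean_space set \<Rightarrow> bool" where
  "root_system \<Phi> \<longleftrightarrow>
     finite \<Phi> \<and> 0 \<notin> \<Phi> \<and> span \<Phi> = UNIV \<and>
     (\<forall>\<alpha>\<in>\<Phi>. \<forall>\<beta>\<in>\<Phi>. reflect \<alpha> \<beta> \<in> \<Phi>) \<and>
     (\<forall>\<alpha>\<in>\<Phi>. \<forall>\<beta>\<in>\<Phi>. \<beta> \<bullet> coroot \<alpha> \<in> \<int>) \<and>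
     (\<forall>\<alpha>\<in>\<Phi>. \<forall>c. c *\<^sub>R \<alpha> \<in> \<Phi> \<longrightarrow> c = 1 \<or> c = -1)"

definition full_lattice :: "'a::euclidean_space set \<Rightarrow> bool" where
  "full_lattice L \<longleftrightarrow> (\<exists>B. independent B \<and> span B = UNIV \<and> L = group_closure B)"

definition root_datum :: "'a::euclidean_space set \<Rightarrow> 'a set \<Rightarrow> bool" where
  "root_datum L \<Phi> \<longleftrightarrow>
     root_system \<Phi> \<and> full_lattice L \<and> \<Phi> \<subseteq> L \<and> (\<forall>x\<in>L. \<forall>\<alpha>\<in>\<Phi>. x \<bullet> coroot \<alpha> \<in> \<int>)"

text \<open>The cocharacter lattice \<open>Hom(S\<^sup>1, T)\<close>, as the lattice dual to \<open>L\<close>.\<close>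

definition cocharacters :: "'a::euclidean_space set \<Rightarrow> 'a set" where
  "cocharacters L = {h. \<forall>x\<in>L. x \<bullet> h \<in> \<int>}"

text \<open>The fundamental group of a compact connected Lie group is the quotient of its cocharacter
  lattice by the subgroup generated by the coroots.\<close>

definition simply_connected_datum :: "'a::euclidean_space set \<Rightarrow> 'a set \<Rightarrow> bool" where
  "simply_connected_datum L \<Phi> \<longleftrightarrow>
     root_datum L \<Phi> \<and> cocharacters L = group_closure (coroot ` \<Phi>)"

definition nonneg_combinations :: "'a::euclidean_space set \<Rightarrow> 'a set" where
  "nonneg_combinations \<Delta> = {x. \<exists>c :: 'a \<Rightarrow> nat. x = (\<Sum>\<delta>\<in>\<Delta>. real (c \<delta>) *\<^sub>R \<delta>)}"

definition root_base :: "'a::euclidean_space set \<Rightarrow> 'a set \<Rightarrow> bool" where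
  "root_base \<Phi> \<Delta> \<longleftrightarrow>
     \<Delta> \<subseteq> \<Phi> \<and> independent \<Delta> \<and>
     (\<forall>\<alpha>\<in>\<Phi>. \<alpha> \<in> nonneg_combinations \<Delta> \<or> - \<alpha> \<in> nonneg_combinations \<Delta>)"

definition positive_roots :: "'a::euclidean_space set \<Rightarrow> 'a set \<Rightarrow> 'a set" where
  "positive_roots \<Phi> \<Delta> = \<Phi> \<inter> nonneg_combinations \<Delta>"

definition highest_root :: "'a::euclidean_space set \<Rightarrow> 'a set \<Rightarrow> 'a" where
  "highest_root \<Phi> \<Delta> = (THE \<theta>. \<theta> \<in> \<Phi> \<and> (\<forall>\<alpha>\<in>\<Phi>. \<theta> - \<alpha> \<in> nonneg_combinations \<Delta>))"

definition long_root :: "'a::euclidean_space set \<Rightarrow> 'a \<Rightarrow> bool" where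
  "long_root \<Phi> u \<longleftrightarrow> u \<in> \<Phi> \<and> (\<forall>v\<in>\<Phi>. v \<bullet> v \<le> u \<bullet> u)"

definition normalized :: "'a::euclidean_space set \<Rightarrow> bool" where
  "normalized \<Phi> \<longleftrightarrow> (\<forall>u. long_root \<Phi> u \<longrightarrow> u \<bullet> u = 2)"

text \<open>Edges of the Dynkin diagram, in Bourbaki's numbering: a chain 1-3-4-5-6, with 2 attached
  to 4.\<close>

definition E6_edges :: "nat set set" where
  "E6_edges = {{1, 3}, {3, 4}, {4, 5}, {5, 6}, {2, 4}}"

definition type_E6 :: "'a::euclidean_space set \<Rightarrow> bool" where
  "type_E6 \<Delta> \<longleftrightarrow>
     (\<exists>a :: nat \<Rightarrow> 'a. bij_betw a {1..6} \<Delta> \<and>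
        (\<forall>i\<in>{1..6}. \<forall>j\<in>{1..6}.
           a i \<bullet> coroot (a j) = (if i = j then 2 else if {i, j} \<in> E6_edges then -1 else 0)))"

definition weyl_chamber :: "'a::euclidean_space set \<Rightarrow> 'a set \<Rightarrow> 'a set" where
  "weyl_chamber \<Phi> \<Delta> = {x. \<forall>\<alpha>\<in>positive_roots \<Phi> \<Delta>. \<alpha> \<bullet> x \<ge> 0}"

definition alcove :: "'a::euclidean_space set \<Rightarrow> 'a set \<Rightarrow> nat \<Rightarrow> 'a set" where
  "alcove \<Phi> \<Delta> m = {x \<in> weyl_chamber \<Phi> \<Delta>. highest_root \<Phi> \<Delta> \<bullet> x \<le> real m}"

definition regular_weights ::
    "'a::euclidean_space set \<Rightarrow> 'a set \<Rightarrow> 'a set \<Rightarrow> nat \<Rightarrow> 'a set" where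
  "regular_weights L \<Phi> \<Delta> m = L \<inter> interior (alcove \<Phi> \<Delta> m)"

text \<open>\<^const>\<open>quotient_of\<close> gives the representation in lowest terms with positive
  denominator.\<close>

definition rational_with_denominator :: "real \<Rightarrow> int \<Rightarrow> bool" where
  "rational_with_denominator x d \<longleftrightarrow> (\<exists>q :: rat. x = of_rat q \<and> snd (quotient_of q) = d)"

definition N ::
    "'a::euclidean_space set \<Rightarrow> 'a set \<Rightarrow> 'a set \<Rightarrow> nat \<Rightarrow> nat \<Rightarrow> nat" where
  "N L \<Phi> \<Delta> m p =
     card {a \<in> regular_weights L \<Phi> \<Delta> m.
             \<forall>w\<in>L. \<exists>k. rational_with_denominator ((w \<bullet> a) / real m) (int p ^ k)}"

definition half_integers :: "real set" where
  "half_integers = (\<lambda>x. x + 1 / 2) ` \<int>"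

text \<open>The parameter \<open>q\<close> is instantiated with \<open>p\<^sup>i\<close>.\<close>

definition star_condition :: "nat \<Rightarrow> real \<times> real \<times> real \<times> real \<times> real \<times> real \<Rightarrow> bool" where
  "star_condition q = (\<lambda>(b1, b2, b3, b4, b5, b6).
     b2 > b3 \<and> b3 > b4 \<and> b4 > b5 \<and> b5 > \<bar>b6\<bar> \<and>
     sqrt 3 * b1 > b2 + b3 + b4 + b5 - b6 \<and>
     real q > 1 / 2 * (sqrt 3 * b1 + b2 + b3 + b4 + b5 + b6) \<and>
     (\<exists>k :: int. sqrt 3 * b1 + b2 + b3 + b4 + b5 + b6 = 2 * of_int k))"

end

theory Submission
  imports Defs
begin

text \<open>
  Every root is conjugate to a simple one, so all roots have norm 2, coroots are roots, and \<open>L\<close> is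
  the lattice dual to the root lattice \<open>Q\<close>. Pairing with the weights of \<open>L\<close>, the denominator
  condition on \<open>a\<close> says that \<open>a = m' c\<close>, where \<open>c\<close> is any weight if \<open>p = 3\<close>, and \<open>c \<in> Q\<close> if \<open>p \<noteq> 3\<close>,
  because \<open>L / Q\<close> has order 3. The alcove inequalities for \<open>a\<close> at level \<open>m\<close> are those for \<open>c\<close> at level
  \<open>p\<^sup>i\<close>. The two cases differ by the condition that 3 divides \<open>u\<^sub>1 - u\<^sub>3 + u\<^sub>5 - u\<^sub>6\<close> on the coordinates
  \<open>u\<^sub>j = \<langle>\<alpha>\<^sub>j, c\<rangle>\<close>, and passing to orthonormal coordinates adapted to \<open>D\<^sub>5 \<subset> E\<^sub>6\<close> turns the points \<open>u\<close>
  into the tuples \<open>b\<close>.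
\<close>

section \<open>Root systems and their weight lattices\<close>

lemma coefficients_unique:
  fixes \<Delta> :: "'a::euclidean_space set"
  assumes "independent \<Delta>" and "(\<Sum>\<delta>\<in>\<Delta>. r \<delta> *\<^sub>R \<delta>) = (\<Sum>\<delta>\<in>\<Delta>. s \<delta> *\<^sub>R \<delta>)" and "\<delta> \<in> \<Delta>"
  shows "r \<delta> = s \<delta>"
proof -
  have "(\<Sum>\<delta>\<in>\<Delta>. (r \<delta> - s \<delta>) *\<^sub>R \<delta>) = 0"
    using assms(2) by (simp add: scaleR_diff_left sum_subtractf)
  then have "r \<delta> - s \<delta> = 0"
    by (rule independentD[OF assms(1) independent_imp_finite[OF assms(1)] subset_refl _ assms(3)])
  then show ?thesis by simp
qed

lemma root_norm_simple:
  fixes \<Phi> :: "'a::euclidean_space set"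
  assumes rs: "root_system \<Phi>" and rb: "root_base \<Phi> \<Delta>" and "\<alpha> \<in> \<Phi>"
  shows "\<exists>\<delta>\<in>\<Delta>. \<alpha> \<bullet> \<alpha> = \<delta> \<bullet> \<delta>"
proof -
  have ind: "independent \<Delta>" and sub: "\<Delta> \<subseteq> \<Phi>" using rb by (auto simp: root_base_def)
  have fin: "finite \<Delta>" using ind by (rule independent_imp_finite)
  have nz: "0 \<notin> \<Phi>" and refl: "\<And>\<alpha> \<beta>. \<alpha> \<in> \<Phi> \<Longrightarrow> \<beta> \<in> \<Phi> \<Longrightarrow> reflect \<alpha> \<beta> \<in> \<Phi>"
    and int: "\<And>\<alpha> \<beta>. \<alpha> \<in> \<Phi> \<Longrightarrow> \<beta> \<in> \<Phi> \<Longrightarrow> \<beta> \<bullet> coroot \<alpha> \<in> \<int>"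
    and red: "\<And>\<alpha> c. \<alpha> \<in> \<Phi> \<Longrightarrow> c *\<^sub>R \<alpha> \<in> \<Phi> \<Longrightarrow> c = 1 \<or> c = -1"
    using rs by (auto simp: root_system_def)
  have positive: "\<exists>\<delta>\<in>\<Delta>. \<alpha> \<bullet> \<alpha> = \<delta> \<bullet> \<delta>"
    if "\<alpha> \<in> \<Phi>" "\<alpha> = (\<Sum>\<delta>\<in>\<Delta>. real (c \<delta>) *\<^sub>R \<delta>)" for \<alpha> and c :: "'a \<Rightarrow> nat"
    using that
  proof (induction "\<Sum>\<delta>\<in>\<Delta>. c \<delta>" arbitrary: \<alpha> c rule: less_induct)
    case less
    have "0 < \<alpha> \<bullet> \<alpha>" using less.prems(1) nz by (metis inner_gt_zero_iff)
    also have "\<alpha> \<bullet> \<alpha> = (\<Sum>\<delta>\<in>\<Delta>. real (c \<delta>) * (\<alpha> \<bullet> \<delta>))"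
      by (subst (2) less.prems(2)) (simp add: inner_sum_right)
    finally obtain \<delta> where \<delta>: "\<delta> \<in> \<Delta>" and gt: "real (c \<delta>) * (\<alpha> \<bullet> \<delta>) > 0"
      by (meson linorder_not_le sum_nonpos)
    from gt have pos: "\<alpha> \<bullet> \<delta> > 0" and cpos: "c \<delta> > 0"
      by (auto simp: zero_less_mult_iff)
    have \<delta>\<Phi>: "\<delta> \<in> \<Phi>" using \<delta> sub by auto
    then have \<delta>0: "\<delta> \<bullet> \<delta> > 0" using nz by (metis inner_gt_zero_iff)
    show ?case
    proof (cases "\<exists>\<delta>'\<in>\<Delta>. \<delta>' \<noteq> \<delta> \<and> c \<delta>' > 0")
      case False
      then have "\<alpha> = (\<Sum>\<delta>'\<in>\<Delta>. if \<delta>' = \<delta> then real (c \<delta>) *\<^sub>R \<delta> else 0)"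
        unfolding less.prems(2) by (intro sum.cong) auto
      also have "\<dots> = real (c \<delta>) *\<^sub>R \<delta>" using \<delta> fin by simp
      finally have e: "\<alpha> = real (c \<delta>) *\<^sub>R \<delta>" .
      then have "real (c \<delta>) = 1" using red[OF \<delta>\<Phi>, of "real (c \<delta>)"] less.prems(1) by auto
      then show ?thesis using e \<delta> by auto
    next
      case True
      then obtain \<delta>' where \<delta>': "\<delta>' \<in> \<Delta>" "\<delta>' \<noteq> \<delta>" "c \<delta>' > 0" by auto
      obtain d :: int where d: "\<alpha> \<bullet> coroot \<delta> = of_int d"
        using int[OF \<delta>\<Phi> less.prems(1)] by (auto elim: Ints_cases)
      have d': "2 * (\<alpha> \<bullet> \<delta>) / (\<delta> \<bullet> \<delta>) = of_int d" using d by (simp add: coroot_def)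
      then have "real_of_int d > 0" using pos \<delta>0 by (metis divide_pos_pos mult_pos_pos zero_less_numeral)
      then have dpos: "d > 0" by simp
      define \<beta> where "\<beta> = reflect \<delta> \<alpha>"
      have \<beta>\<Phi>: "\<beta> \<in> \<Phi>" using refl[OF \<delta>\<Phi> less.prems(1)] by (simp add: \<beta>_def)
      have \<beta>eq: "\<beta> = \<alpha> - of_int d *\<^sub>R \<delta>" by (simp add: \<beta>_def reflect_def d')
      have norm: "\<beta> \<bullet> \<beta> = \<alpha> \<bullet> \<alpha>"
        unfolding \<beta>_def reflect_def using \<delta>0
        by (simp add: inner_diff_left inner_diff_right inner_commute field_simps)
      define r where "r = (\<lambda>\<epsilon>. real (c \<epsilon>) - (if \<epsilon> = \<delta> then of_int d else 0))"
      have "(\<Sum>\<epsilon>\<in>\<Delta>. (if \<epsilon> = \<delta> then real_of_int d else 0) *\<^sub>R \<epsilon>) = (\<Sum>\<epsilon>\<in>\<Delta>. if \<epsilon> = \<delta> then real_of_int d *\<^sub>R \<delta> else 0)"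
        by (intro sum.cong) auto
      then have \<beta>r: "\<beta> = (\<Sum>\<epsilon>\<in>\<Delta>. r \<epsilon> *\<^sub>R \<epsilon>)"
        unfolding \<beta>eq r_def using \<delta> fin less.prems(2)
        by (simp add: scaleR_diff_left sum_subtractf)
      show ?thesis
      proof (cases "\<beta> \<in> nonneg_combinations \<Delta>")
        case True
        then obtain e :: "'a \<Rightarrow> nat" where e: "\<beta> = (\<Sum>\<epsilon>\<in>\<Delta>. real (e \<epsilon>) *\<^sub>R \<epsilon>)"
          by (auto simp: nonneg_combinations_def)
        have er: "real (e \<epsilon>) = r \<epsilon>" if "\<epsilon> \<in> \<Delta>" for \<epsilon>
          by (rule coefficients_unique[OF ind _ that]) (use e \<beta>r in simp)
        have "sum e \<Delta> < sum c \<Delta>"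
        proof (rule sum_strict_mono_ex1[OF fin])
          show "\<forall>\<epsilon>\<in>\<Delta>. e \<epsilon> \<le> c \<epsilon>"
            using er dpos unfolding r_def by (smt (verit) of_int_0_le_iff of_nat_le_iff)
          show "\<exists>\<epsilon>\<in>\<Delta>. e \<epsilon> < c \<epsilon>"
            using er[OF \<delta>] \<delta> dpos unfolding r_def
            by (intro bexI[of _ \<delta>]) (smt (verit) of_int_0_less_iff of_nat_less_iff)
        qed
        then show ?thesis using less.hyps[OF _ \<beta>\<Phi> e] norm by simp
      next
        case False
        then have "- \<beta> \<in> nonneg_combinations \<Delta>" using rb \<beta>\<Phi> by (auto simp: root_base_def)
        then obtain e :: "'a \<Rightarrow> nat" where e: "- \<beta> = (\<Sum>\<epsilon>\<in>\<Delta>. real (e \<epsilon>) *\<^sub>R \<epsilon>)"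
          by (auto simp: nonneg_combinations_def)
        have "\<beta> = (\<Sum>\<epsilon>\<in>\<Delta>. (- real (e \<epsilon>)) *\<^sub>R \<epsilon>)"
          using e by (simp add: sum_negf minus_equation_iff[of \<beta>])
        then have "- real (e \<delta>') = r \<delta>'"
          by (intro coefficients_unique[OF ind _ \<delta>'(1)]) (use \<beta>r in simp)
        then show ?thesis using \<delta>' by (simp add: r_def)
      qed
    qed
  qed
  show ?thesis
  proof (cases "\<alpha> \<in> nonneg_combinations \<Delta>")
    case True
    then show ?thesis using positive[OF \<open>\<alpha> \<in> \<Phi>\<close>] by (auto simp: nonneg_combinations_def)
  next
    case False
    then have "- \<alpha> \<in> nonneg_combinations \<Delta>" using rb \<open>\<alpha> \<in> \<Phi>\<close> by (auto simp: root_base_def)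
    moreover have "reflect \<alpha> \<alpha> = - \<alpha>"
      using \<open>\<alpha> \<in> \<Phi>\<close> nz by (auto simp: reflect_def scaleR_2)
    then have "- \<alpha> \<in> \<Phi>" using refl[OF \<open>\<alpha> \<in> \<Phi>\<close> \<open>\<alpha> \<in> \<Phi>\<close>] by simp
    ultimately obtain c :: "'a \<Rightarrow> nat" where "- \<alpha> = (\<Sum>\<delta>\<in>\<Delta>. real (c \<delta>) *\<^sub>R \<delta>)" "- \<alpha> \<in> \<Phi>"
      by (auto simp: nonneg_combinations_def)
    then have "\<exists>\<delta>\<in>\<Delta>. (- \<alpha>) \<bullet> (- \<alpha>) = \<delta> \<bullet> \<delta>" by (intro positive)
    then show ?thesis by simp
  qed
qed

lemma group_closure_inner_Ints:
  fixes S :: "'a::euclidean_space set"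
  assumes "x \<in> group_closure S" and "\<And>s. s \<in> S \<Longrightarrow> y \<bullet> s \<in> \<int>"
  shows "y \<bullet> x \<in> \<int>"
  using assms(1)
proof induction
  case (base s)
  then show ?case using assms(2) by auto
next
  case (diff s t)
  then show ?case unfolding inner_diff_right by (intro Ints_diff)
qed

lemma full_lattice_bidual:
  fixes L :: "'a::euclidean_space set"
  assumes "full_lattice L"
  shows "L = {x. \<forall>h\<in>cocharacters L. x \<bullet> h \<in> \<int>}"
proof -
  obtain B where ind: "independent B" and span: "span B = UNIV" and L: "L = group_closure B"
    using assms by (auto simp: full_lattice_def)
  have fin: "finite B" using ind by (rule independent_imp_finite)
  define dual where "dual b = (\<Sum>e\<in>Basis. representation B e b *\<^sub>R e)" for b
  have dual: "x \<bullet> dual b = representation B x b" for x b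
  proof -
    define f where "f x = representation B x b" for x
    have lin: "linear f"
      using ind span by (intro linearI) (auto simp: f_def representation_add representation_scale)
    have "f (\<Sum>e\<in>Basis. (x \<bullet> e) *\<^sub>R e) = (\<Sum>e\<in>Basis. (x \<bullet> e) * f e)"
      by (simp add: linear_sum[OF lin] linear_scale[OF lin])
    then show ?thesis by (simp add: euclidean_representation dual_def inner_sum_right mult.commute f_def)
  qed
  have dual_cochar: "dual b \<in> cocharacters L" for b
  proof -
    have "dual b \<bullet> x \<in> \<int>" if "x \<in> L" for x
      using that unfolding L
      by (rule group_closure_inner_Ints)
        (simp add: inner_commute dual representation_basis[OF ind])
    then show ?thesis by (simp add: cocharacters_def inner_commute)
  qed
  have scale: "of_int z *\<^sub>R b \<in> group_closure B" if "b \<in> B" for z :: int and b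
  proof (induction z rule: int_induct[where k = 0])
    case (step1 i)
    then show ?case using group_closure_add[OF step1(2) group_closure.base[of b B]] that
      by (simp add: scaleR_add_left)
  next
    case (step2 i)
    then show ?case using group_closure.diff[OF step2(2) group_closure.base[of b B]] that
      by (simp add: scaleR_diff_left)
  qed simp
  have "x \<in> L" if x: "\<forall>h\<in>cocharacters L. x \<bullet> h \<in> \<int>" for x
  proof -
    have x_eq: "x = (\<Sum>b\<in>B. representation B x b *\<^sub>R b)"
      using sum_representation_eq[OF ind _ fin, of x] span by simp
    have mem: "representation B x b *\<^sub>R b \<in> L" if "b \<in> B" for b
    proof -
      have "representation B x b \<in> \<int>" using x dual_cochar[of b] by (metis dual)
      then show ?thesis using scale[OF that] by (auto simp: L elim!: Ints_cases)
    qed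
    have sum_mem: "sum f S \<in> L" if "finite S" "\<And>s. s \<in> S \<Longrightarrow> f s \<in> L" for f :: "'a \<Rightarrow> 'a" and S
      using that by (induction S rule: finite_induct) (auto simp: L intro: group_closure_add)
    show ?thesis by (subst x_eq) (intro sum_mem fin mem)
  qed
  then show ?thesis by (auto simp: cocharacters_def)
qed

lemma rational_with_prime_power_denominator_iff:
  assumes "prime p"
  shows "(\<exists>k. rational_with_denominator x (int p ^ k)) \<longleftrightarrow> (\<exists>k. x * real p ^ k \<in> \<int>)"
proof
  assume "\<exists>k. rational_with_denominator x (int p ^ k)"
  then obtain k q n where x: "x = of_rat q" and "quotient_of q = (n, int p ^ k)"
    by (metis rational_with_denominator_def prod.collapse)
  then have "q = of_int n / of_int (int p ^ k)" by (rule_tac quotient_of_div)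
  then have "x * real p ^ k = of_int n"
    using x prime_gt_0_nat[OF assms] by (simp add: of_rat_divide of_rat_power)
  then show "\<exists>k. x * real p ^ k \<in> \<int>" by (metis Ints_of_int)
next
  assume "\<exists>k. x * real p ^ k \<in> \<int>"
  then obtain k z where z: "x * real p ^ k = of_int z" by (auto elim: Ints_cases)
  have p0: "int p ^ k > 0" using prime_gt_0_nat[OF assms] by simp
  have x: "x = of_rat (Fract z (int p ^ k))"
    using z p0 by (simp add: of_rat_rat field_simps)
  have "snd (quotient_of (Fract z (int p ^ k))) = int p ^ k div gcd z (int p ^ k)"
    using p0 by (simp add: quotient_of_Fract Rat.normalize_def Let_def)
  moreover have "int p ^ k div gcd z (int p ^ k) dvd int p ^ k"
    by (rule div_dvd_iff_mult[THEN iffD2]) (use p0 in auto)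
  then obtain j where "normalize (int p ^ k div gcd z (int p ^ k)) = int p ^ j"
    using divides_primepow[of "int p"] assms by (metis prime_nat_int_transfer)
  moreover have "int p ^ k div gcd z (int p ^ k) \<ge> 0"
    using p0 by (simp add: pos_imp_zdiv_nonneg_iff)
  ultimately show "\<exists>k. rational_with_denominator x (int p ^ k)"
    unfolding rational_with_denominator_def using x by auto
qed

section \<open>Roots and alcove of \<open>E\<^sub>6\<close>\<close>

lemma nonneg_combinations_subset_span: "nonneg_combinations \<Delta> \<subseteq> span \<Delta>"
  unfolding nonneg_combinations_def by clarify (intro span_sum span_scale span_base)

locale e6_root_datum =
  fixes L \<Phi> :: "'a::euclidean_space set" and a1 a2 a3 a4 a5 a6 :: 'a
  assumes root_system: "root_system \<Phi>"
    and root_base: "root_base \<Phi> {a1, a2, a3, a4, a5, a6}"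
    and root_norm: "\<alpha> \<in> \<Phi> \<Longrightarrow> \<alpha> \<bullet> \<alpha> = 2"
    and gram:
      "a1 \<bullet> a1 = 2" "a1 \<bullet> a2 = 0" "a1 \<bullet> a3 = -1" "a1 \<bullet> a4 = 0" "a1 \<bullet> a5 = 0" "a1 \<bullet> a6 = 0"
      "a2 \<bullet> a1 = 0" "a2 \<bullet> a2 = 2" "a2 \<bullet> a3 = 0" "a2 \<bullet> a4 = -1" "a2 \<bullet> a5 = 0" "a2 \<bullet> a6 = 0"
      "a3 \<bullet> a1 = -1" "a3 \<bullet> a2 = 0" "a3 \<bullet> a3 = 2" "a3 \<bullet> a4 = -1" "a3 \<bullet> a5 = 0" "a3 \<bullet> a6 = 0"
      "a4 \<bullet> a1 = 0" "a4 \<bullet> a2 = -1" "a4 \<bullet> a3 = -1" "a4 \<bullet> a4 = 2" "a4 \<bullet> a5 = -1" "a4 \<bullet> a6 = 0"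
      "a5 \<bullet> a1 = 0" "a5 \<bullet> a2 = 0" "a5 \<bullet> a3 = 0" "a5 \<bullet> a4 = -1" "a5 \<bullet> a5 = 2" "a5 \<bullet> a6 = -1"
      "a6 \<bullet> a1 = 0" "a6 \<bullet> a2 = 0" "a6 \<bullet> a3 = 0" "a6 \<bullet> a4 = 0" "a6 \<bullet> a5 = -1" "a6 \<bullet> a6 = 2"
    and mem_L_iff: "x \<in> L \<longleftrightarrow> (\<forall>\<delta>\<in>{a1, a2, a3, a4, a5, a6}. x \<bullet> \<delta> \<in> \<int>)"
begin

definition comb :: "real \<Rightarrow> real \<Rightarrow> real \<Rightarrow> real \<Rightarrow> real \<Rightarrow> real \<Rightarrow> 'a" where
  "comb y1 y2 y3 y4 y5 y6 = y1 *\<^sub>R a1 + y2 *\<^sub>R a2 + y3 *\<^sub>R a3 + y4 *\<^sub>R a4 + y5 *\<^sub>R a5 + y6 *\<^sub>R a6"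

text \<open>The coefficients are the rows of the inverse of the Cartan matrix.\<close>

definition weight :: "real \<Rightarrow> real \<Rightarrow> real \<Rightarrow> real \<Rightarrow> real \<Rightarrow> real \<Rightarrow> 'a" where
  "weight u1 u2 u3 u4 u5 u6 = comb
     ((4 * u1 + 3 * u2 + 5 * u3 + 6 * u4 + 4 * u5 + 2 * u6) / 3)
     ((3 * u1 + 6 * u2 + 6 * u3 + 9 * u4 + 6 * u5 + 3 * u6) / 3)
     ((5 * u1 + 6 * u2 + 10 * u3 + 12 * u4 + 8 * u5 + 4 * u6) / 3)
     ((6 * u1 + 9 * u2 + 12 * u3 + 18 * u4 + 12 * u5 + 6 * u6) / 3)
     ((4 * u1 + 6 * u2 + 8 * u3 + 12 * u4 + 10 * u5 + 5 * u6) / 3)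
     ((2 * u1 + 3 * u2 + 4 * u3 + 6 * u4 + 5 * u5 + 4 * u6) / 3)"

lemma distinct_simple_roots: "distinct [a1, a2, a3, a4, a5, a6]"
  using gram by auto

lemma inner_comb:
  "x \<bullet> comb y1 y2 y3 y4 y5 y6 =
     y1 * (x \<bullet> a1) + y2 * (x \<bullet> a2) + y3 * (x \<bullet> a3) + y4 * (x \<bullet> a4) + y5 * (x \<bullet> a5) + y6 * (x \<bullet> a6)"
  by (simp add: comb_def inner_add_right)

lemma comb_inner_simple:
  "comb y1 y2 y3 y4 y5 y6 \<bullet> a1 = 2 * y1 - y3"
  "comb y1 y2 y3 y4 y5 y6 \<bullet> a2 = 2 * y2 - y4"
  "comb y1 y2 y3 y4 y5 y6 \<bullet> a3 = - y1 + 2 * y3 - y4"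
  "comb y1 y2 y3 y4 y5 y6 \<bullet> a4 = - y2 - y3 + 2 * y4 - y5"
  "comb y1 y2 y3 y4 y5 y6 \<bullet> a5 = - y4 + 2 * y5 - y6"
  "comb y1 y2 y3 y4 y5 y6 \<bullet> a6 = - y5 + 2 * y6"
  by (simp_all add: comb_def inner_add_left gram)

lemma weight_inner_simple:
  "weight u1 u2 u3 u4 u5 u6 \<bullet> a1 = u1"
  "weight u1 u2 u3 u4 u5 u6 \<bullet> a2 = u2"
  "weight u1 u2 u3 u4 u5 u6 \<bullet> a3 = u3"
  "weight u1 u2 u3 u4 u5 u6 \<bullet> a4 = u4"
  "weight u1 u2 u3 u4 u5 u6 \<bullet> a5 = u5"
  "weight u1 u2 u3 u4 u5 u6 \<bullet> a6 = u6"
  by (simp_all add: weight_def comb_inner_simple field_simps)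

lemma inner_weight:
  "w \<bullet> weight u1 u2 u3 u4 u5 u6 =
     (4 * u1 + 3 * u2 + 5 * u3 + 6 * u4 + 4 * u5 + 2 * u6) / 3 * (w \<bullet> a1) +
     (3 * u1 + 6 * u2 + 6 * u3 + 9 * u4 + 6 * u5 + 3 * u6) / 3 * (w \<bullet> a2) +
     (5 * u1 + 6 * u2 + 10 * u3 + 12 * u4 + 8 * u5 + 4 * u6) / 3 * (w \<bullet> a3) +
     (6 * u1 + 9 * u2 + 12 * u3 + 18 * u4 + 12 * u5 + 6 * u6) / 3 * (w \<bullet> a4) +
     (4 * u1 + 6 * u2 + 8 * u3 + 12 * u4 + 10 * u5 + 5 * u6) / 3 * (w \<bullet> a5) +
     (2 * u1 + 3 * u2 + 4 * u3 + 6 * u4 + 5 * u5 + 4 * u6) / 3 * (w \<bullet> a6)"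
  by (simp add: weight_def inner_comb)

lemma span_simple_roots: "span {a1, a2, a3, a4, a5, a6} = UNIV"
proof -
  have "\<Phi> \<subseteq> span {a1, a2, a3, a4, a5, a6}"
  proof
    fix \<alpha> assume "\<alpha> \<in> \<Phi>"
    then have "\<alpha> \<in> span {a1, a2, a3, a4, a5, a6} \<or> - \<alpha> \<in> span {a1, a2, a3, a4, a5, a6}"
      using root_base nonneg_combinations_subset_span[of "{a1, a2, a3, a4, a5, a6}"]
      unfolding root_base_def by blast
    then show "\<alpha> \<in> span {a1, a2, a3, a4, a5, a6}"
      using span_neg[of "- \<alpha>"] by (elim disjE) simp_all
  qed
  then have "span \<Phi> \<subseteq> span {a1, a2, a3, a4, a5, a6}" by (rule span_minimal) (rule subspace_span)
  then show ?thesis using root_system by (auto simp: root_system_def)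
qed

lemma eq_weight: "x = weight (x \<bullet> a1) (x \<bullet> a2) (x \<bullet> a3) (x \<bullet> a4) (x \<bullet> a5) (x \<bullet> a6)"
proof -
  let ?y = "weight (x \<bullet> a1) (x \<bullet> a2) (x \<bullet> a3) (x \<bullet> a4) (x \<bullet> a5) (x \<bullet> a6)"
  have "span {a1, a2, a3, a4, a5, a6} \<subseteq> {z. (x - ?y) \<bullet> z = 0}"
    by (rule span_minimal[OF _ subspace_hyperplane]) (auto simp: inner_diff_left weight_inner_simple)
  then have "(x - ?y) \<bullet> (x - ?y) = 0" using span_simple_roots by blast
  then show ?thesis by simp
qed

lemma nonneg_combinations_iff:
  "x \<in> nonneg_combinations {a1, a2, a3, a4, a5, a6} \<longleftrightarrow>
    (\<exists>c1 c2 c3 c4 c5 c6 :: nat. x = comb (real c1) (real c2) (real c3) (real c4) (real c5) (real c6))"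
proof
  assume "x \<in> nonneg_combinations {a1, a2, a3, a4, a5, a6}"
  then obtain c :: "'a \<Rightarrow> nat" where "x = (\<Sum>\<delta>\<in>{a1, a2, a3, a4, a5, a6}. real (c \<delta>) *\<^sub>R \<delta>)"
    by (auto simp only: nonneg_combinations_def)
  then have "x = comb (real (c a1)) (real (c a2)) (real (c a3)) (real (c a4)) (real (c a5)) (real (c a6))"
    using distinct_simple_roots by (simp add: comb_def)
  then show "\<exists>c1 c2 c3 c4 c5 c6 :: nat. x = comb (real c1) (real c2) (real c3) (real c4) (real c5) (real c6)"
    by blast
next
  assume "\<exists>c1 c2 c3 c4 c5 c6 :: nat. x = comb (real c1) (real c2) (real c3) (real c4) (real c5) (real c6)"
  then obtain c1 c2 c3 c4 c5 c6 :: nat where x: "x = comb (real c1) (real c2) (real c3) (real c4) (real c5) (real c6)"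
    by blast
  define c where "c = (\<lambda>\<delta>. if \<delta> = a1 then c1 else if \<delta> = a2 then c2 else if \<delta> = a3 then c3 else if \<delta> = a4 then c4 else if \<delta> = a5 then c5 else c6)"
  have "c a1 = c1 \<and> c a2 = c2 \<and> c a3 = c3 \<and> c a4 = c4 \<and> c a5 = c5 \<and> c a6 = c6"
    using distinct_simple_roots by (auto simp: c_def)
  then have "x = (\<Sum>\<delta>\<in>{a1, a2, a3, a4, a5, a6}. real (c \<delta>) *\<^sub>R \<delta>)"
    using distinct_simple_roots by (simp add: comb_def x)
  then show "x \<in> nonneg_combinations {a1, a2, a3, a4, a5, a6}"
    unfolding nonneg_combinations_def by blast
qed

lemma simple_root_mem: "a1 \<in> \<Phi>" "a2 \<in> \<Phi>" "a3 \<in> \<Phi>" "a4 \<in> \<Phi>" "a5 \<in> \<Phi>" "a6 \<in> \<Phi>"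
  using root_base by (auto simp: root_base_def)

lemma add_root_mem:
  assumes "\<beta> \<in> \<Phi>" "\<alpha> \<in> \<Phi>" "\<beta> \<bullet> \<alpha> = -1"
  shows "\<beta> + \<alpha> \<in> \<Phi>"
proof -
  have "reflect \<alpha> \<beta> \<in> \<Phi>" using root_system assms by (auto simp: root_system_def)
  then show ?thesis using assms by (simp add: reflect_def root_norm)
qed

lemma comb_add_simple:
  "comb y1 y2 y3 y4 y5 y6 + a1 = comb (y1 + 1) y2 y3 y4 y5 y6"
  "comb y1 y2 y3 y4 y5 y6 + a2 = comb y1 (y2 + 1) y3 y4 y5 y6"
  "comb y1 y2 y3 y4 y5 y6 + a3 = comb y1 y2 (y3 + 1) y4 y5 y6"
  "comb y1 y2 y3 y4 y5 y6 + a4 = comb y1 y2 y3 (y4 + 1) y5 y6"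
  "comb y1 y2 y3 y4 y5 y6 + a5 = comb y1 y2 y3 y4 (y5 + 1) y6"
  "comb y1 y2 y3 y4 y5 y6 + a6 = comb y1 y2 y3 y4 y5 (y6 + 1)"
  by (simp_all add: comb_def scaleR_add_left)

lemma highest_comb_mem: "comb 1 2 2 3 2 1 \<in> \<Phi>"
proof -
  have "comb 1 0 0 0 0 0 \<in> \<Phi>" by (simp add: comb_def simple_root_mem)
  from add_root_mem[OF this simple_root_mem(3)] have "comb 1 0 1 0 0 0 \<in> \<Phi>"
    by (simp add: comb_inner_simple comb_add_simple)
  from add_root_mem[OF this simple_root_mem(4)] have "comb 1 0 1 1 0 0 \<in> \<Phi>"
    by (simp add: comb_inner_simple comb_add_simple)
  from add_root_mem[OF this simple_root_mem(2)] have "comb 1 1 1 1 0 0 \<in> \<Phi>"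
    by (simp add: comb_inner_simple comb_add_simple)
  from add_root_mem[OF this simple_root_mem(5)] have "comb 1 1 1 1 1 0 \<in> \<Phi>"
    by (simp add: comb_inner_simple comb_add_simple)
  from add_root_mem[OF this simple_root_mem(6)] have "comb 1 1 1 1 1 1 \<in> \<Phi>"
    by (simp add: comb_inner_simple comb_add_simple)
  from add_root_mem[OF this simple_root_mem(4)] have "comb 1 1 1 2 1 1 \<in> \<Phi>"
    by (simp add: comb_inner_simple comb_add_simple)
  from add_root_mem[OF this simple_root_mem(3)] have "comb 1 1 2 2 1 1 \<in> \<Phi>"
    by (simp add: comb_inner_simple comb_add_simple)
  from add_root_mem[OF this simple_root_mem(5)] have "comb 1 1 2 2 2 1 \<in> \<Phi>"
    by (simp add: comb_inner_simple comb_add_simple)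
  from add_root_mem[OF this simple_root_mem(4)] have "comb 1 1 2 3 2 1 \<in> \<Phi>"
    by (simp add: comb_inner_simple comb_add_simple)
  from add_root_mem[OF this simple_root_mem(2)] show ?thesis
    by (simp add: comb_inner_simple comb_add_simple)
qed

text \<open>The coefficient of a root at a simple root is its inner product with a fundamental weight,
  so the Cauchy-Schwarz inequality bounds it; for \<open>E\<^sub>6\<close> these bounds are sharp.\<close>

lemma root_coefficients_le:
  assumes "comb (real c1) (real c2) (real c3) (real c4) (real c5) (real c6) \<in> \<Phi>"
  shows "c1 \<le> 1" "c2 \<le> 2" "c3 \<le> 2" "c4 \<le> 3" "c5 \<le> 2" "c6 \<le> 1"
proof -
  let ?\<alpha> = "comb (real c1) (real c2) (real c3) (real c4) (real c5) (real c6)"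
  have bound: "c \<le> n" if "w \<bullet> ?\<alpha> = real c" "w \<bullet> w * 2 < (real n + 1)\<^sup>2" for w c n
  proof -
    have "(real c)\<^sup>2 \<le> w \<bullet> w * 2"
      using Cauchy_Schwarz_ineq[of w ?\<alpha>] that(1) root_norm[OF assms] by simp
    also have "\<dots> < (real n + 1)\<^sup>2" by (rule that(2))
    finally have "real c < real n + 1" by (rule power_less_imp_less_base) simp
    then show ?thesis by linarith
  qed
  note simps = inner_comb weight_inner_simple power2_eq_square
  show "c1 \<le> 1"
    by (rule bound[of "weight 1 0 0 0 0 0"]) (simp_all add: inner_weight simps)
  show "c2 \<le> 2"
    by (rule bound[of "weight 0 1 0 0 0 0"]) (simp_all add: inner_weight simps)
  show "c3 \<le> 2"
    by (rule bound[of "weight 0 0 1 0 0 0"]) (simp_all add: inner_weight simps)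
  show "c4 \<le> 3"
    by (rule bound[of "weight 0 0 0 1 0 0"]) (simp_all add: inner_weight simps)
  show "c5 \<le> 2"
    by (rule bound[of "weight 0 0 0 0 1 0"]) (simp_all add: inner_weight simps)
  show "c6 \<le> 1"
    by (rule bound[of "weight 0 0 0 0 0 1"]) (simp_all add: inner_weight simps)
qed

lemma highest_root_eq: "highest_root \<Phi> {a1, a2, a3, a4, a5, a6} = comb 1 2 2 3 2 1"
  unfolding highest_root_def
proof (rule the_equality)
  have dominates: "comb 1 2 2 3 2 1 - \<alpha> \<in> nonneg_combinations {a1, a2, a3, a4, a5, a6}" if "\<alpha> \<in> \<Phi>" for \<alpha>
  proof (cases "\<alpha> \<in> nonneg_combinations {a1, a2, a3, a4, a5, a6}")
    case True
    then obtain c1 c2 c3 c4 c5 c6 where \<alpha>: "\<alpha> = comb (real c1) (real c2) (real c3) (real c4) (real c5) (real c6)"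
      by (auto simp: nonneg_combinations_iff)
    note le = root_coefficients_le[OF that[unfolded \<alpha>]]
    have "comb 1 2 2 3 2 1 - \<alpha> =
      comb (real (1 - c1)) (real (2 - c2)) (real (2 - c3)) (real (3 - c4)) (real (2 - c5)) (real (1 - c6))"
      using le by (simp add: \<alpha> comb_def of_nat_diff algebra_simps)
    then show ?thesis unfolding nonneg_combinations_iff by blast
  next
    case False
    then have "- \<alpha> \<in> nonneg_combinations {a1, a2, a3, a4, a5, a6}"
      using root_base that by (auto simp only: root_base_def)
    then obtain c1 c2 c3 c4 c5 c6 where \<alpha>: "- \<alpha> = comb (real c1) (real c2) (real c3) (real c4) (real c5) (real c6)"
      by (auto simp: nonneg_combinations_iff)
    have "comb 1 2 2 3 2 1 - \<alpha> = comb 1 2 2 3 2 1 + comb (real c1) (real c2) (real c3) (real c4) (real c5) (real c6)"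
      by (simp flip: \<alpha>)
    also have "\<dots> =
      comb (real (1 + c1)) (real (2 + c2)) (real (2 + c3)) (real (3 + c4)) (real (2 + c5)) (real (1 + c6))"
      by (simp add: comb_def algebra_simps)
    finally show ?thesis unfolding nonneg_combinations_iff by blast
  qed
  then show "comb 1 2 2 3 2 1 \<in> \<Phi> \<and> (\<forall>\<alpha>\<in>\<Phi>. comb 1 2 2 3 2 1 - \<alpha> \<in> nonneg_combinations {a1, a2, a3, a4, a5, a6})"
    using highest_comb_mem by blast
  fix \<theta> assume \<theta>: "\<theta> \<in> \<Phi> \<and> (\<forall>\<alpha>\<in>\<Phi>. \<theta> - \<alpha> \<in> nonneg_combinations {a1, a2, a3, a4, a5, a6})"
  obtain c1 c2 c3 c4 c5 c6 :: nat where c: "\<theta> - comb 1 2 2 3 2 1 = comb (real c1) (real c2) (real c3) (real c4) (real c5) (real c6)"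
    using \<theta> highest_comb_mem nonneg_combinations_iff by blast
  obtain d1 d2 d3 d4 d5 d6 :: nat where d: "comb 1 2 2 3 2 1 - \<theta> = comb (real d1) (real d2) (real d3) (real d4) (real d5) (real d6)"
    using \<theta> dominates nonneg_combinations_iff by blast
  have "comb (real c1) (real c2) (real c3) (real c4) (real c5) (real c6) + comb (real d1) (real d2) (real d3) (real d4) (real d5) (real d6) = 0"
    unfolding c[symmetric] d[symmetric] by simp
  then have "w \<bullet> comb (real c1) (real c2) (real c3) (real c4) (real c5) (real c6) + w \<bullet> comb (real d1) (real d2) (real d3) (real d4) (real d5) (real d6) = 0" for w
    by (metis inner_add_right inner_zero_right)
  from this[of "weight 1 0 0 0 0 0"] this[of "weight 0 1 0 0 0 0"] this[of "weight 0 0 1 0 0 0"] this[of "weight 0 0 0 1 0 0"] this[of "weight 0 0 0 0 1 0"] this[of "weight 0 0 0 0 0 1"]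
  have "c1 = 0 \<and> c2 = 0 \<and> c3 = 0 \<and> c4 = 0 \<and> c5 = 0 \<and> c6 = 0"
    by (simp add: inner_comb weight_inner_simple)
  then show "\<theta> = comb 1 2 2 3 2 1" using c by (simp add: comb_def)
qed

lemma alcove_eq:
  "alcove \<Phi> {a1, a2, a3, a4, a5, a6} m =
    {x. a1 \<bullet> x \<ge> 0} \<inter> {x. a2 \<bullet> x \<ge> 0} \<inter> {x. a3 \<bullet> x \<ge> 0} \<inter>
    {x. a4 \<bullet> x \<ge> 0} \<inter> {x. a5 \<bullet> x \<ge> 0} \<inter> {x. a6 \<bullet> x \<ge> 0} \<inter>
    {x. comb 1 2 2 3 2 1 \<bullet> x \<le> real m}"
proof -
  have "\<alpha> \<bullet> x \<ge> 0"
    if "\<alpha> \<in> nonneg_combinations {a1, a2, a3, a4, a5, a6}"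
      "a1 \<bullet> x \<ge> 0" "a2 \<bullet> x \<ge> 0" "a3 \<bullet> x \<ge> 0" "a4 \<bullet> x \<ge> 0" "a5 \<bullet> x \<ge> 0" "a6 \<bullet> x \<ge> 0" for \<alpha> x
    using that by (auto simp: nonneg_combinations_iff comb_def inner_add_left)
  moreover have "\<delta> \<in> positive_roots \<Phi> {a1, a2, a3, a4, a5, a6}" if "\<delta> \<in> {a1, a2, a3, a4, a5, a6}" for \<delta>
  proof -
    have "finite {a1, a2, a3, a4, a5, a6}" by simp
    then have "\<delta> = (\<Sum>\<epsilon>\<in>{a1, a2, a3, a4, a5, a6}. if \<epsilon> = \<delta> then \<delta> else 0)"
      using that by (simp only: sum.delta if_True)
    also have "\<dots> = (\<Sum>\<epsilon>\<in>{a1, a2, a3, a4, a5, a6}. real (if \<epsilon> = \<delta> then 1 else 0) *\<^sub>R \<epsilon>)"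
      by (rule sum.cong) auto
    finally have "\<delta> \<in> nonneg_combinations {a1, a2, a3, a4, a5, a6}"
      unfolding nonneg_combinations_def by (intro CollectI exI)
    then show ?thesis using that root_base by (auto simp only: root_base_def positive_roots_def)
  qed
  ultimately show ?thesis
    unfolding alcove_def weyl_chamber_def highest_root_eq by (auto simp: positive_roots_def)
qed

lemma regular_weights_iff:
  "x \<in> regular_weights L \<Phi> {a1, a2, a3, a4, a5, a6} m \<longleftrightarrow> x \<in> L \<and>
    x \<bullet> a1 > 0 \<and> x \<bullet> a2 > 0 \<and> x \<bullet> a3 > 0 \<and> x \<bullet> a4 > 0 \<and> x \<bullet> a5 > 0 \<and> x \<bullet> a6 > 0 \<and>
    x \<bullet> a1 + 2 * (x \<bullet> a2) + 2 * (x \<bullet> a3) + 3 * (x \<bullet> a4) + 2 * (x \<bullet> a5) + x \<bullet> a6 < real m"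
proof -
  have nz: "\<alpha> \<noteq> 0" if "\<alpha> \<in> \<Phi>" for \<alpha>
    using root_norm[OF that] by auto
  show ?thesis
    unfolding regular_weights_def alcove_eq
    by (simp add: interior_halfspace_ge interior_halfspace_le nz simple_root_mem highest_comb_mem
        inner_commute[of _ x] inner_comb)
qed

end

section \<open>The denominator condition\<close>

definition e6_points :: "nat \<Rightarrow> int \<Rightarrow> (int \<times> int \<times> int \<times> int \<times> int \<times> int) set" where
  "e6_points q d = {(u1, u2, u3, u4, u5, u6).
     u1 > 0 \<and> u2 > 0 \<and> u3 > 0 \<and> u4 > 0 \<and> u5 > 0 \<and> u6 > 0 \<and>
     u1 + 2 * u2 + 2 * u3 + 3 * u4 + 2 * u5 + u6 < int q \<and> d dvd u1 - u3 + u5 - u6}"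

lemma dvd_numerator:
  assumes "p > 0" and "m' > 0" and "e \<noteq> 0" and "coprime (int p) (e * int m')"
    and "of_int z / of_int e / real (p ^ i * m') * real p ^ k \<in> \<int>"
  shows "e * int m' dvd z"
proof -
  obtain y where y: "of_int z / of_int e / real (p ^ i * m') * real p ^ k = of_int y"
    using assms(5) by (auto elim: Ints_cases)
  have "of_int (z * int p ^ k) = (of_int (y * int p ^ i * (e * int m')) :: real)"
    using y assms(1-3) by (simp add: field_simps)
  then have "z * int p ^ k = y * int p ^ i * (e * int m')" by (simp only: of_int_eq_iff)
  then have "e * int m' dvd z * int p ^ k" by simp
  moreover have "coprime (e * int m') (int p ^ k)"
    using assms(4) by (simp only: coprime_power_right_iff coprime_commute) simp
  ultimately show ?thesis by (simp add: coprime_dvd_mult_left_iff)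
qed

lemma of_int_divide_Ints:
  assumes "d dvd z"
  shows "(of_int z :: real) / of_int d \<in> \<int>"
  using assms by (auto elim!: dvdE)

context e6_root_datum
begin

lemma weight_mem_L: "weight (real_of_int u1) (real_of_int u2) (real_of_int u3) (real_of_int u4) (real_of_int u5) (real_of_int u6) \<in> L"
  by (simp add: mem_L_iff weight_inner_simple)

lemma first_fundamental_weight_inner:
  "weight 1 0 0 0 0 0 \<bullet> weight u1 u2 u3 u4 u5 u6 = (4 * u1 + 3 * u2 + 5 * u3 + 6 * u4 + 4 * u5 + 2 * u6) / 3"
  by (simp add: inner_weight weight_inner_simple field_simps)

lemma inner_weight_Ints:
  assumes "w \<in> L"
  shows "3 * (w \<bullet> weight (real_of_int u1) (real_of_int u2) (real_of_int u3) (real_of_int u4) (real_of_int u5) (real_of_int u6)) \<in> \<int>"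
    and "3 dvd u1 - u3 + u5 - u6 \<Longrightarrow> w \<bullet> weight (real_of_int u1) (real_of_int u2) (real_of_int u3) (real_of_int u4) (real_of_int u5) (real_of_int u6) \<in> \<int>"
proof -
  have "w \<bullet> a1 \<in> \<int>" "w \<bullet> a2 \<in> \<int>" "w \<bullet> a3 \<in> \<int>" "w \<bullet> a4 \<in> \<int>" "w \<bullet> a5 \<in> \<int>" "w \<bullet> a6 \<in> \<int>"
    using assms by (simp_all add: mem_L_iff)
  then obtain v1 v2 v3 v4 v5 v6 where
    "w \<bullet> a1 = of_int v1" "w \<bullet> a2 = of_int v2" "w \<bullet> a3 = of_int v3"
    "w \<bullet> a4 = of_int v4" "w \<bullet> a5 = of_int v5" "w \<bullet> a6 = of_int v6"
    by (elim Ints_cases)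
  then have eq: "w \<bullet> weight (real_of_int u1) (real_of_int u2) (real_of_int u3) (real_of_int u4) (real_of_int u5) (real_of_int u6) = of_int (
        (v1 + 2 * v3 + v5 + 2 * v6) * (u1 - u3 + u5 - u6) +
        3 * ((u1 + u2 + 2 * u3 + 2 * u4 + u5 + u6) * v1 +
          (u1 + 2 * u2 + 2 * u3 + 3 * u4 + 2 * u5 + u6) * v2 +
          (u1 + 2 * u2 + 4 * u3 + 4 * u4 + 2 * u5 + 2 * u6) * v3 +
          (2 * u1 + 3 * u2 + 4 * u3 + 6 * u4 + 4 * u5 + 2 * u6) * v4 +
          (u1 + 2 * u2 + 3 * u3 + 4 * u4 + 3 * u5 + 2 * u6) * v5 +
          (u2 + 2 * u3 + 2 * u4 + u5 + 2 * u6) * v6)) / 3"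
    by (simp add: inner_weight field_simps)
  show "3 * (w \<bullet> weight (real_of_int u1) (real_of_int u2) (real_of_int u3) (real_of_int u4) (real_of_int u5) (real_of_int u6)) \<in> \<int>"
    unfolding eq by (simp del: of_int_add of_int_mult)
  assume "3 dvd u1 - u3 + u5 - u6"
  then have "3 dvd
        (v1 + 2 * v3 + v5 + 2 * v6) * (u1 - u3 + u5 - u6) +
        3 * ((u1 + u2 + 2 * u3 + 2 * u4 + u5 + u6) * v1 +
          (u1 + 2 * u2 + 2 * u3 + 3 * u4 + 2 * u5 + u6) * v2 +
          (u1 + 2 * u2 + 4 * u3 + 4 * u4 + 2 * u5 + 2 * u6) * v3 +
          (2 * u1 + 3 * u2 + 4 * u3 + 6 * u4 + 4 * u5 + 2 * u6) * v4 +
          (u1 + 2 * u2 + 3 * u3 + 4 * u4 + 3 * u5 + 2 * u6) * v5 +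
          (u2 + 2 * u3 + 2 * u4 + u5 + 2 * u6) * v6)"
    by (intro dvd_add dvd_mult dvd_triv_left)
  from of_int_divide_Ints[OF this] show "w \<bullet> weight (real_of_int u1) (real_of_int u2) (real_of_int u3) (real_of_int u4) (real_of_int u5) (real_of_int u6) \<in> \<int>"
    unfolding eq by simp
qed

lemma N_eq_card_e6_points:
  assumes "prime p" and "m' > 0" and "\<not> p dvd m'"
  shows "N L \<Phi> {a1, a2, a3, a4, a5, a6} (p ^ i * m') p = card (e6_points (p ^ i) (if p = 3 then 1 else 3))"
proof -
  let ?d = "if p = 3 then 1 else 3 :: int"
  let ?A = "{a \<in> regular_weights L \<Phi> {a1, a2, a3, a4, a5, a6} (p ^ i * m').
    \<forall>w\<in>L. \<exists>k. rational_with_denominator ((w \<bullet> a) / real (p ^ i * m')) (int p ^ k)}"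
  have p0: "p > 0" using assms(1) by (rule prime_gt_0_nat)
  have cop: "coprime (int p) (int m')"
    using assms by (simp add: prime_imp_coprime)
  have cop3: "coprime (int p) (3 * int m')" if "p \<noteq> 3"
  proof -
    have "coprime p 3" using assms(1) that by (simp add: primes_coprime)
    then have "coprime (int p) (int 3)" by (simp only: coprime_int_iff)
    then show ?thesis using cop by simp
  qed
  define f :: "int \<times> int \<times> int \<times> int \<times> int \<times> int \<Rightarrow> 'a" where
    "f = (\<lambda>(u1, u2, u3, u4, u5, u6). real m' *\<^sub>R weight (real_of_int u1) (real_of_int u2) (real_of_int u3) (real_of_int u4) (real_of_int u5) (real_of_int u6))"
  have f_inner: "f (u1, u2, u3, u4, u5, u6) \<bullet> a1 = real m' * of_int u1" "f (u1, u2, u3, u4, u5, u6) \<bullet> a2 = real m' * of_int u2"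
    "f (u1, u2, u3, u4, u5, u6) \<bullet> a3 = real m' * of_int u3" "f (u1, u2, u3, u4, u5, u6) \<bullet> a4 = real m' * of_int u4"
    "f (u1, u2, u3, u4, u5, u6) \<bullet> a5 = real m' * of_int u5" "f (u1, u2, u3, u4, u5, u6) \<bullet> a6 = real m' * of_int u6" for u1 u2 u3 u4 u5 u6 :: int
    by (simp_all add: f_def weight_inner_simple)
  have f_L: "f (u1, u2, u3, u4, u5, u6) \<in> L" for u1 u2 u3 u4 u5 u6
    by (simp add: mem_L_iff f_inner)
  have f_level: "real m' * of_int u1 + 2 * (real m' * of_int u2) + 2 * (real m' * of_int u3) + 3 * (real m' * of_int u4) + 2 * (real m' * of_int u5) + real m' * of_int u6 < real (p ^ i * m')
      \<longleftrightarrow> u1 + 2 * u2 + 2 * u3 + 3 * u4 + 2 * u5 + u6 < int (p ^ i)" for u1 u2 u3 u4 u5 u6 :: int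
  proof -
    have "real m' * of_int u1 + 2 * (real m' * of_int u2) + 2 * (real m' * of_int u3) + 3 * (real m' * of_int u4) + 2 * (real m' * of_int u5) + real m' * of_int u6 < real (p ^ i * m')
      \<longleftrightarrow> real m' * of_int (u1 + 2 * u2 + 2 * u3 + 3 * u4 + 2 * u5 + u6) < real m' * of_int (int (p ^ i))"
      by (simp add: algebra_simps)
    also have "\<dots> \<longleftrightarrow> u1 + 2 * u2 + 2 * u3 + 3 * u4 + 2 * u5 + u6 < int (p ^ i)"
      using assms(2) by (simp only: mult_less_cancel_left_pos of_nat_0_less_iff of_int_less_iff)
    finally show ?thesis .
  qed
  have f_regular: "f (u1, u2, u3, u4, u5, u6) \<in> regular_weights L \<Phi> {a1, a2, a3, a4, a5, a6} (p ^ i * m') \<longleftrightarrow>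
      u1 > 0 \<and> u2 > 0 \<and> u3 > 0 \<and> u4 > 0 \<and> u5 > 0 \<and> u6 > 0 \<and>
      u1 + 2 * u2 + 2 * u3 + 3 * u4 + 2 * u5 + u6 < int (p ^ i)" for u1 u2 u3 u4 u5 u6
    unfolding regular_weights_iff f_inner f_level using assms(2) f_L
    by (simp add: zero_less_mult_iff)
  have "bij_betw f (e6_points (p ^ i) ?d) ?A"
  proof (rule bij_betw_imageI)
    show "inj_on f (e6_points (p ^ i) ?d)"
    proof (rule inj_onI)
      fix s t assume "f s = f t"
      obtain u1 u2 u3 u4 u5 u6 v1 v2 v3 v4 v5 v6 where
        st: "s = (u1, u2, u3, u4, u5, u6)" "t = (v1, v2, v3, v4, v5, v6)"
        by (cases s, cases t) blast
      have "f (u1, u2, u3, u4, u5, u6) \<bullet> a = f (v1, v2, v3, v4, v5, v6) \<bullet> a" for a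
        using \<open>f s = f t\<close> by (simp add: st)
      from this[of a1] this[of a2] this[of a3] this[of a4] this[of a5] this[of a6]
      show "s = t"
        using assms(2) by (simp add: f_inner st)
    qed
    show "f ` e6_points (p ^ i) ?d = ?A"
    proof (intro equalityI subsetI)
      fix a assume "a \<in> f ` e6_points (p ^ i) ?d"
      then obtain u1 u2 u3 u4 u5 u6 where a: "a = f (u1, u2, u3, u4, u5, u6)" and u: "(u1, u2, u3, u4, u5, u6) \<in> e6_points (p ^ i) ?d"
        by auto
      have "\<exists>k. w \<bullet> a / real (p ^ i * m') * real p ^ k \<in> \<int>" if "w \<in> L" for w
      proof -
        have *: "w \<bullet> a / real (p ^ i * m') = w \<bullet> weight (real_of_int u1) (real_of_int u2) (real_of_int u3) (real_of_int u4) (real_of_int u5) (real_of_int u6) / real p ^ i"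
          using assms(2) by (simp add: a f_def)
        show ?thesis
        proof (cases "p = 3")
          case True
          have "w \<bullet> a / real (p ^ i * m') * real p ^ Suc i = 3 * (w \<bullet> weight (real_of_int u1) (real_of_int u2) (real_of_int u3) (real_of_int u4) (real_of_int u5) (real_of_int u6))"
            unfolding * using True by simp
          then show ?thesis using inner_weight_Ints(1)[OF that] by metis
        next
          case False
          then have "3 dvd u1 - u3 + u5 - u6" using u by (simp add: e6_points_def)
          moreover have "w \<bullet> a / real (p ^ i * m') * real p ^ i = w \<bullet> weight (real_of_int u1) (real_of_int u2) (real_of_int u3) (real_of_int u4) (real_of_int u5) (real_of_int u6)"
            unfolding * using p0 by simp
          ultimately show ?thesis using inner_weight_Ints(2)[OF that] by metis
        qed
      qed
      moreover have "a \<in> regular_weights L \<Phi> {a1, a2, a3, a4, a5, a6} (p ^ i * m')"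
        unfolding a f_regular using u by (simp add: e6_points_def)
      ultimately show "a \<in> ?A"
        by (simp add: rational_with_prime_power_denominator_iff[OF assms(1)] del: of_nat_mult of_nat_power)
    next
      fix a assume "a \<in> ?A"
      then have reg: "a \<in> regular_weights L \<Phi> {a1, a2, a3, a4, a5, a6} (p ^ i * m')"
        and den: "\<And>w. w \<in> L \<Longrightarrow> \<exists>k. w \<bullet> a / real (p ^ i * m') * real p ^ k \<in> \<int>"
        by (simp_all add: rational_with_prime_power_denominator_iff[OF assms(1)] del: of_nat_mult of_nat_power)
      have "a \<in> L" using reg by (simp add: regular_weights_def)
      have simple: "\<exists>u :: int. a \<bullet> \<delta> = real m' * of_int u" if "\<delta> \<in> {a1, a2, a3, a4, a5, a6}" for \<delta>
      proof -
        have "a \<bullet> \<delta> \<in> \<int>" using \<open>a \<in> L\<close> that unfolding mem_L_iff by blast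
        then obtain z where z: "a \<bullet> \<delta> = of_int z" by (elim Ints_cases)
        have "\<delta> \<in> L" using that by (auto simp: mem_L_iff gram)
        then obtain k where "of_int z / of_int 1 / real (p ^ i * m') * real p ^ k \<in> \<int>"
          using den[of \<delta>] z by (auto simp: inner_commute)
        from dvd_numerator[OF p0 assms(2) _ _ this] have "int m' dvd z" using cop by simp
        then show ?thesis using z by (auto elim!: dvdE)
      qed
      obtain u1 u2 u3 u4 u5 u6 :: int where
        ai: "a \<bullet> a1 = real m' * of_int u1" "a \<bullet> a2 = real m' * of_int u2" "a \<bullet> a3 = real m' * of_int u3"
          "a \<bullet> a4 = real m' * of_int u4" "a \<bullet> a5 = real m' * of_int u5" "a \<bullet> a6 = real m' * of_int u6"
        using simple[of a1] simple[of a2] simple[of a3] simple[of a4] simple[of a5] simple[of a6] by blast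
      have a: "a = f (u1, u2, u3, u4, u5, u6)"
        by (subst (1 2) eq_weight) (simp only: ai f_inner)
      have "?d dvd u1 - u3 + u5 - u6"
      proof (cases "p = 3")
        case False
        let ?z = "int m' * (4 * u1 + 3 * u2 + 5 * u3 + 6 * u4 + 4 * u5 + 2 * u6)"
        have "weight 1 0 0 0 0 0 \<in> L" using weight_mem_L[of 1 0 0 0 0 0] by simp
        from den[OF this] obtain k where
          "weight 1 0 0 0 0 0 \<bullet> a / real (p ^ i * m') * real p ^ k \<in> \<int>" by blast
        moreover have "weight 1 0 0 0 0 0 \<bullet> a = of_int ?z / of_int 3"
          by (simp add: a f_def first_fundamental_weight_inner)
        ultimately have "of_int ?z / of_int 3 / real (p ^ i * m') * real p ^ k \<in> \<int>" by simp
        from dvd_numerator[OF p0 assms(2) _ cop3[OF False] this]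
        have "int m' * 3 dvd int m' * (4 * u1 + 3 * u2 + 5 * u3 + 6 * u4 + 4 * u5 + 2 * u6)" by (simp add: mult.commute)
        then have "3 dvd 4 * u1 + 3 * u2 + 5 * u3 + 6 * u4 + 4 * u5 + 2 * u6" using assms(2) by simp
        also have "4 * u1 + 3 * u2 + 5 * u3 + 6 * u4 + 4 * u5 + 2 * u6 = (u1 - u3 + u5 - u6) + (u1 + u2 + 2 * u3 + 2 * u4 + u5 + u6) * 3" by simp
        finally have "3 dvd u1 - u3 + u5 - u6" by (simp only: dvd_add_times_triv_right_iff)
        then show ?thesis using False by simp
      qed simp
      then have "(u1, u2, u3, u4, u5, u6) \<in> e6_points (p ^ i) ?d"
        using reg unfolding a f_regular e6_points_def by simp
      then show "a \<in> f ` e6_points (p ^ i) ?d" using a by blast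
    qed
  qed
  then show ?thesis unfolding N_def by (rule bij_betw_same_card[symmetric])
qed

end

section \<open>Orthonormal coordinates\<close>

text \<open>The components of \<open>e6_tuple u\<close> are the coordinates of the vector with inner products \<open>u\<close> with
  the simple roots \<open>(\<surd>3/2, -1/2, -1/2, -1/2, -1/2, 1/2)\<close>, \<open>e\<^sub>5 + e\<^sub>6\<close>, \<open>e\<^sub>5 - e\<^sub>6\<close>, \<open>e\<^sub>4 - e\<^sub>5\<close>, \<open>e\<^sub>3 - e\<^sub>4\<close>,
  \<open>e\<^sub>2 - e\<^sub>3\<close> of \<open>\<real>\<^sup>6\<close>, in Bourbaki's numbering.\<close>

definition e6_tuple ::
    "int \<times> int \<times> int \<times> int \<times> int \<times> int \<Rightarrow> real \<times> real \<times> real \<times> real \<times> real \<times> real" where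
  "e6_tuple = (\<lambda>(u1, u2, u3, u4, u5, u6).
     (of_int (4 * u1 + 3 * u2 + 5 * u3 + 6 * u4 + 4 * u5 + 2 * u6) / (2 * sqrt 3),
      of_int (u2 + u3 + 2 * u4 + 2 * u5 + 2 * u6) / 2,
      of_int (u2 + u3 + 2 * u4 + 2 * u5) / 2,
      of_int (u2 + u3 + 2 * u4) / 2,
      of_int (u2 + u3) / 2,
      of_int (u2 - u3) / 2))"

definition e6_tuples :: "int \<Rightarrow> (real \<times> real \<times> real \<times> real \<times> real \<times> real) set" where
  "e6_tuples d = {(b1, b2, b3, b4, b5, b6). \<exists>S\<in>{\<int>, half_integers}.
     sqrt 3 * b1 / of_int d \<in> S \<and> b2 \<in> S \<and> b3 \<in> S \<and> b4 \<in> S \<and> b5 \<in> S \<and> b6 \<in> S}"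

lemma half_integers_iff: "x \<in> half_integers \<longleftrightarrow> (\<exists>z. x = of_int z + 1 / 2)"
  unfolding half_integers_def by (auto elim!: Ints_cases)

lemma half_of_int_mem:
  assumes "even z \<longleftrightarrow> P"
  shows "of_int z / 2 \<in> (if P then \<int> else half_integers)"
  using assms by (auto simp: half_integers_iff elim!: evenE oddE)

lemma half_of_int_cases:
  assumes "S \<in> {\<int>, half_integers}" and "x \<in> S"
  obtains z where "x = of_int z / 2" and "even z \<longleftrightarrow> S = \<int>"
proof (cases "S = \<int>")
  case True
  then obtain z where "x = of_int z" using assms(2) by (auto elim: Ints_cases)
  then show ?thesis using True that[of "2 * z"] by simp
next
  case False
  then obtain z where "x = of_int z + 1 / 2" using assms by (auto simp: half_integers_iff)
  then show ?thesis using False that[of "2 * z + 1"] by (simp add: add_divide_distrib)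
qed

lemma image_mult_iff:
  fixes c :: real
  assumes "c \<noteq> 0"
  shows "x \<in> (\<lambda>y. c * y) ` S \<longleftrightarrow> x / c \<in> S"
  using assms by (auto intro!: image_eqI[of _ _ "x / c"])

lemma sqrt3_mult_eq: "sqrt 3 * (x / (2 * sqrt 3)) = x / 2"
  by (simp add: field_simps)

lemma sum_of_e6_tuple:
  assumes "(b1, b2, b3, b4, b5, b6) = e6_tuple (u1, u2, u3, u4, u5, u6)"
  shows "sqrt 3 * b1 + b2 + b3 + b4 + b5 + b6 = 2 * of_int (u1 + 2 * u2 + 2 * u3 + 3 * u4 + 2 * u5 + u6)"
    and "sqrt 3 * b1 - (b2 + b3 + b4 + b5 - b6) = 2 * of_int u1"
  using assms by (simp_all add: e6_tuple_def sqrt3_mult_eq del: times_divide_eq_right) (simp_all add: field_simps)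

lemma e6_tuple_star:
  "star_condition q (e6_tuple (u1, u2, u3, u4, u5, u6)) \<longleftrightarrow>
     u1 > 0 \<and> u2 > 0 \<and> u3 > 0 \<and> u4 > 0 \<and> u5 > 0 \<and> u6 > 0 \<and>
     u1 + 2 * u2 + 2 * u3 + 3 * u4 + 2 * u5 + u6 < int q"
proof -
  obtain b1 b2 b3 b4 b5 b6 where b: "(b1, b2, b3, b4, b5, b6) = e6_tuple (u1, u2, u3, u4, u5, u6)"
    by (metis prod.collapse)
  have "b2 - b3 = of_int u6" "b3 - b4 = of_int u5" "b4 - b5 = of_int u4" "b5 - b6 = of_int u3" "b5 + b6 = of_int u2"
    using b by (simp_all add: e6_tuple_def field_simps)
  then have "b2 > b3 \<longleftrightarrow> u6 > 0" "b3 > b4 \<longleftrightarrow> u5 > 0" "b4 > b5 \<longleftrightarrow> u4 > 0" "b5 > \<bar>b6\<bar> \<longleftrightarrow> u2 > 0 \<and> u3 > 0"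
    by linarith+
  moreover have "sqrt 3 * b1 > b2 + b3 + b4 + b5 - b6 \<longleftrightarrow> u1 > 0"
    using sum_of_e6_tuple(2)[OF b] by linarith
  moreover have "real q > 1 / 2 * (sqrt 3 * b1 + b2 + b3 + b4 + b5 + b6) \<longleftrightarrow>
      u1 + 2 * u2 + 2 * u3 + 3 * u4 + 2 * u5 + u6 < int q"
    unfolding sum_of_e6_tuple(1)[OF b]
    by (simp only: of_int_less_iff[where 'a = real, symmetric] of_int_of_nat_eq)
      (simp del: of_int_add of_int_mult)
  moreover have "\<exists>k :: int. sqrt 3 * b1 + b2 + b3 + b4 + b5 + b6 = 2 * of_int k"
    using sum_of_e6_tuple(1)[OF b] by (rule exI)
  ultimately show ?thesis
    unfolding b[symmetric] star_condition_def by auto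
qed

lemma e6_tuples_eq:
  assumes "c * sqrt 3 = of_int d" and "c \<noteq> 0"
  shows "((\<lambda>x. c * x) ` \<int> \<times> \<int> \<times> \<int> \<times> \<int> \<times> \<int> \<times> \<int>) \<union>
      ((\<lambda>x. c * x) ` half_integers \<times> half_integers \<times> half_integers \<times>
        half_integers \<times> half_integers \<times> half_integers) = e6_tuples d"
proof -
  have "sqrt 3 * x / of_int d = x / c" for x
    using assms(2) by (simp flip: assms(1))
  then show ?thesis
    using assms(2) by (auto simp: e6_tuples_def image_mult_iff)
qed

lemma card_e6_tuples:
  assumes d: "d = 1 \<or> d = 3"
  shows "card {b \<in> e6_tuples d. star_condition q b} = card (e6_points q d)"
proof -
  have "bij_betw e6_tuple (e6_points q d) {b \<in> e6_tuples d. star_condition q b}"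
  proof (rule bij_betw_imageI)
    show "inj_on e6_tuple (e6_points q d)"
      by (rule inj_onI) (auto simp: e6_tuple_def)
    show "e6_tuple ` e6_points q d = {b \<in> e6_tuples d. star_condition q b}"
    proof (intro equalityI subsetI)
      fix b assume "b \<in> e6_tuple ` e6_points q d"
      then obtain u1 u2 u3 u4 u5 u6 where b: "b = e6_tuple (u1, u2, u3, u4, u5, u6)" and u: "(u1, u2, u3, u4, u5, u6) \<in> e6_points q d"
        by auto
      have "star_condition q b"
        unfolding b e6_tuple_star using u by (simp add: e6_points_def)
      moreover have "b \<in> e6_tuples d"
      proof -
        have "d dvd u1 - u3 + u5 - u6" using u by (simp add: e6_points_def)
        then have "d dvd (u1 - u3 + u5 - u6) + (u1 + u2 + 2 * u3 + 2 * u4 + u5 + u6) * 3"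
          using d by (elim disjE) (simp_all only: dvd_add_times_triv_right_iff one_dvd)
        also have "(u1 - u3 + u5 - u6) + (u1 + u2 + 2 * u3 + 2 * u4 + u5 + u6) * 3 = 4 * u1 + 3 * u2 + 5 * u3 + 6 * u4 + 4 * u5 + 2 * u6" by simp
        finally obtain y where y: "4 * u1 + 3 * u2 + 5 * u3 + 6 * u4 + 4 * u5 + 2 * u6 = d * y" by (elim dvdE)
        have "even (d * y) \<longleftrightarrow> even (4 * u1 + 3 * u2 + 5 * u3 + 6 * u4 + 4 * u5 + 2 * u6)" by (simp only: y)
        then have even_y: "even y \<longleftrightarrow> even (u2 - u3)" using d by auto
        have b1: "sqrt 3 * (of_int (4 * u1 + 3 * u2 + 5 * u3 + 6 * u4 + 4 * u5 + 2 * u6) / (2 * sqrt 3)) / of_int d = of_int y / 2"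
          unfolding y sqrt3_mult_eq using d by auto
        show ?thesis
          unfolding b e6_tuples_def e6_tuple_def mem_Collect_eq case_prod_conv b1
          by (intro bexI[of _ "if even (u2 - u3) then \<int> else half_integers"] conjI half_of_int_mem)
            (simp_all add: even_y)
      qed
      ultimately show "b \<in> {b \<in> e6_tuples d. star_condition q b}" by simp
    next
      fix b assume "b \<in> {b \<in> e6_tuples d. star_condition q b}"
      then have star: "star_condition q b" and "b \<in> e6_tuples d" by simp_all
      obtain b1 b2 b3 b4 b5 b6 where b: "b = (b1, b2, b3, b4, b5, b6)" by (metis prod.collapse)
      obtain S where S: "S \<in> {\<int>, half_integers}" and mem: "sqrt 3 * b1 / of_int d \<in> S"
        "b2 \<in> S" "b3 \<in> S" "b4 \<in> S" "b5 \<in> S" "b6 \<in> S"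
        using \<open>b \<in> e6_tuples d\<close> unfolding b e6_tuples_def by blast
      obtain z1 where z1: "sqrt 3 * b1 / of_int d = of_int z1 / 2"
        using half_of_int_cases[OF S mem(1)] by blast
      obtain z2 where z2: "b2 = of_int z2 / 2" "even z2 \<longleftrightarrow> S = \<int>" by (rule half_of_int_cases[OF S mem(2)])
      obtain z3 where z3: "b3 = of_int z3 / 2" "even z3 \<longleftrightarrow> S = \<int>" by (rule half_of_int_cases[OF S mem(3)])
      obtain z4 where z4: "b4 = of_int z4 / 2" "even z4 \<longleftrightarrow> S = \<int>" by (rule half_of_int_cases[OF S mem(4)])
      obtain z5 where z5: "b5 = of_int z5 / 2" "even z5 \<longleftrightarrow> S = \<int>" by (rule half_of_int_cases[OF S mem(5)])
      obtain z6 where z6: "b6 = of_int z6 / 2" "even z6 \<longleftrightarrow> S = \<int>" by (rule half_of_int_cases[OF S mem(6)])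
      have "even (z5 - z6)" "even (z4 - z5)" "even (z3 - z4)" "even (z2 - z3)"
        using z2(2) z3(2) z4(2) z5(2) z6(2) by simp_all
      then obtain u3 u4 u5 u6 where u:
        "z5 - z6 = 2 * u3" "z4 - z5 = 2 * u4" "z3 - z4 = 2 * u5" "z2 - z3 = 2 * u6"
        by (elim evenE)
      have b1: "sqrt 3 * b1 = of_int (d * z1) / 2" using z1 d by (auto simp: field_simps)
      obtain k :: int where "sqrt 3 * b1 + b2 + b3 + b4 + b5 + b6 = 2 * of_int k"
        using star unfolding b star_condition_def by auto
      then have "real_of_int (d * z1 + z2 + z3 + z4 + z5 + z6) = of_int (4 * k)"
        unfolding b1 z2(1) z3(1) z4(1) z5(1) z6(1) by simp
      then have k: "d * z1 + z2 + z3 + z4 + z5 + z6 = 4 * k" by (simp only: of_int_eq_iff)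
      define u2 where "u2 = z6 + u3"
      define u1 where "u1 = k - (2 * z6 + 4 * u3 + 3 * u4 + 2 * u5 + u6)"
      have z: "z2 = u2 + u3 + 2 * u4 + 2 * u5 + 2 * u6" "z3 = u2 + u3 + 2 * u4 + 2 * u5"
        "z4 = u2 + u3 + 2 * u4" "z5 = u2 + u3" "z6 = u2 - u3"
        using u by (simp_all add: u2_def)
      have dz1: "4 * u1 + 3 * u2 + 5 * u3 + 6 * u4 + 4 * u5 + 2 * u6 = d * z1"
        using k z by (simp add: u1_def)
      have "b1 = of_int (d * z1) / (2 * sqrt 3)"
        using b1 by (simp add: field_simps)
      then have b_eq: "b = e6_tuple (u1, u2, u3, u4, u5, u6)"
        unfolding b e6_tuple_def case_prod_conv dz1 by (simp add: z2(1) z3(1) z4(1) z5(1) z6(1) z)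
      have "d dvd 4 * u1 + 3 * u2 + 5 * u3 + 6 * u4 + 4 * u5 + 2 * u6" unfolding dz1 by simp
      also have "4 * u1 + 3 * u2 + 5 * u3 + 6 * u4 + 4 * u5 + 2 * u6 = (u1 - u3 + u5 - u6) + (u1 + u2 + 2 * u3 + 2 * u4 + u5 + u6) * 3" by simp
      finally have "d dvd u1 - u3 + u5 - u6"
        using d by (elim disjE) (simp_all only: dvd_add_times_triv_right_iff one_dvd)
      then have "(u1, u2, u3, u4, u5, u6) \<in> e6_points q d"
        using star unfolding b_eq e6_tuple_star by (simp add: e6_points_def)
      then show "b \<in> e6_tuple ` e6_points q d" using b_eq by blast
    qed
  qed
  then show ?thesis by (rule bij_betw_same_card[symmetric])
qed

section \<open>Reduction to simple root coordinates\<close>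

lemma type_E6_gram:
  assumes rs: "root_system \<Phi>" and rb: "root_base \<Phi> \<Delta>" and "type_E6 \<Delta>" and "normalized \<Phi>"
  obtains a :: "nat \<Rightarrow> 'a::euclidean_space" where "\<Delta> = a ` {1..6}"
    and "\<And>i j. i \<in> {1..6} \<Longrightarrow> j \<in> {1..6} \<Longrightarrow>
      a i \<bullet> a j = (if i = j then 2 else if {i, j} \<in> E6_edges then -1 else 0)"
    and "\<And>\<alpha>. \<alpha> \<in> \<Phi> \<Longrightarrow> \<alpha> \<bullet> \<alpha> = 2"
proof -
  obtain a :: "nat \<Rightarrow> 'a" where bij: "bij_betw a {1..6} \<Delta>" and cartan:
    "\<And>i j. i \<in> {1..6} \<Longrightarrow> j \<in> {1..6} \<Longrightarrow>
      a i \<bullet> coroot (a j) = (if i = j then 2 else if {i, j} \<in> E6_edges then -1 else 0)"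
    using \<open>type_E6 \<Delta>\<close> unfolding type_E6_def by blast
  have \<Delta>: "\<Delta> = a ` {1..6}" using bij by (simp add: bij_betw_def)
  have a_mem: "a i \<in> \<Phi>" if "i \<in> {1..6}" for i
    using that rb unfolding root_base_def \<Delta> by blast
  have pos: "a i \<bullet> a i > 0" if "i \<in> {1..6}" for i
    using a_mem[OF that] rs by (metis inner_gt_zero_iff root_system_def)
  have edge: "a i \<bullet> a i = a j \<bullet> a j" if "i \<in> {1..6}" "j \<in> {1..6}" "{i, j} \<in> E6_edges" "i \<noteq> j" for i j
  proof -
    have "2 * (a i \<bullet> a j) / (a j \<bullet> a j) = -1" "2 * (a j \<bullet> a i) / (a i \<bullet> a i) = -1"
      using cartan[OF that(1,2)] cartan[OF that(2,1)] that(3,4)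
      by (simp_all add: coroot_def insert_commute)
    then show ?thesis using pos[OF that(1)] pos[OF that(2)] by (simp add: field_simps inner_commute)
  qed
  have "a 1 \<bullet> a 1 = a 3 \<bullet> a 3" "a 3 \<bullet> a 3 = a 4 \<bullet> a 4" "a 4 \<bullet> a 4 = a 5 \<bullet> a 5"
    "a 5 \<bullet> a 5 = a 6 \<bullet> a 6" "a 2 \<bullet> a 2 = a 4 \<bullet> a 4"
    by (rule edge; simp add: E6_edges_def)+
  moreover have "{1..6} = {1, 2, 3, 4, 5, 6 :: nat}" by auto
  ultimately have simple_norm: "\<delta> \<bullet> \<delta> = a 1 \<bullet> a 1" if "\<delta> \<in> \<Delta>" for \<delta>
    using that unfolding \<Delta> by auto
  have norm1: "\<alpha> \<bullet> \<alpha> = a 1 \<bullet> a 1" if "\<alpha> \<in> \<Phi>" for \<alpha>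
    using root_norm_simple[OF rs rb that] simple_norm by auto
  have "long_root \<Phi> (a 1)"
    unfolding long_root_def
  proof (intro conjI ballI)
    show "a 1 \<in> \<Phi>" by (rule a_mem) simp
    show "\<alpha> \<bullet> \<alpha> \<le> a 1 \<bullet> a 1" if "\<alpha> \<in> \<Phi>" for \<alpha> using norm1[OF that] by simp
  qed
  then have "a 1 \<bullet> a 1 = 2" using \<open>normalized \<Phi>\<close> by (simp add: normalized_def)
  then have norm: "\<alpha> \<bullet> \<alpha> = 2" if "\<alpha> \<in> \<Phi>" for \<alpha> using norm1[OF that] by simp
  show ?thesis
  proof (rule that[OF \<Delta> _ norm])
    fix i j :: nat assume "i \<in> {1..6}" "j \<in> {1..6}"
    then show "a i \<bullet> a j = (if i = j then 2 else if {i, j} \<in> E6_edges then -1 else 0)"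
      using cartan[of i j] norm[OF a_mem[of j]] by (simp add: coroot_def)
  qed
qed

lemma mem_weight_lattice_iff:
  fixes L \<Phi> :: "'a::euclidean_space set"
  assumes "simply_connected_datum L \<Phi>" and rb: "root_base \<Phi> \<Delta>"
    and norm: "\<And>\<alpha>. \<alpha> \<in> \<Phi> \<Longrightarrow> \<alpha> \<bullet> \<alpha> = 2"
  shows "x \<in> L \<longleftrightarrow> (\<forall>\<delta>\<in>\<Delta>. x \<bullet> \<delta> \<in> \<int>)"
proof -
  have rd: "root_datum L \<Phi>" and cochar: "cocharacters L = group_closure (coroot ` \<Phi>)"
    using assms(1) by (auto simp: simply_connected_datum_def)
  have coroot: "coroot \<alpha> = \<alpha>" if "\<alpha> \<in> \<Phi>" for \<alpha>
    using norm[OF that] by (simp add: coroot_def)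
  have sub: "\<Delta> \<subseteq> \<Phi>" using rb by (simp add: root_base_def)
  show ?thesis
  proof
    assume "x \<in> L"
    then show "\<forall>\<delta>\<in>\<Delta>. x \<bullet> \<delta> \<in> \<int>"
      using rd sub coroot unfolding root_datum_def by (metis subsetD)
  next
    assume x: "\<forall>\<delta>\<in>\<Delta>. x \<bullet> \<delta> \<in> \<int>"
    have comb: "x \<bullet> \<alpha> \<in> \<int>" if "\<alpha> \<in> nonneg_combinations \<Delta>" for \<alpha>
    proof -
      obtain c :: "'a \<Rightarrow> nat" where "\<alpha> = (\<Sum>\<delta>\<in>\<Delta>. real (c \<delta>) *\<^sub>R \<delta>)"
        using \<open>\<alpha> \<in> nonneg_combinations \<Delta>\<close> by (auto simp: nonneg_combinations_def)
      then show ?thesis using x by (auto simp: inner_sum_right intro!: Ints_sum Ints_mult)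
    qed
    have "x \<bullet> coroot \<alpha> \<in> \<int>" if "\<alpha> \<in> \<Phi>" for \<alpha>
    proof -
      have "\<alpha> \<in> nonneg_combinations \<Delta> \<or> - \<alpha> \<in> nonneg_combinations \<Delta>"
        using rb that by (simp add: root_base_def)
      then have "x \<bullet> \<alpha> \<in> \<int>" using comb[of \<alpha>] comb[of "- \<alpha>"] by auto
      then show ?thesis by (simp add: coroot that)
    qed
    then have "x \<bullet> h \<in> \<int>" if "h \<in> cocharacters L" for h
      using that unfolding cochar by (rule_tac group_closure_inner_Ints) auto
    moreover have "full_lattice L" using rd by (simp add: root_datum_def)
    ultimately show "x \<in> L" using full_lattice_bidual by blast
  qed
qed

theorem mainTheorem10:
  fixes L \<Phi> \<Delta> :: "'a::euclidean_space set"
    and m p i m' :: nat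
  assumes "simply_connected_datum L \<Phi>"
    and "root_base \<Phi> \<Delta>"
    and "type_E6 \<Delta>"
    and "normalized \<Phi>"
    and "m > 0"
    and "prime p"
    and "m = p ^ i * m'"
    and "\<not> p dvd m'"
  shows "(p = 3 \<longrightarrow>
            N L \<Phi> \<Delta> m 3 =
              card {b \<in> ((\<lambda>x. 1 / sqrt 3 * x) ` \<int> \<times> \<int> \<times> \<int> \<times> \<int> \<times> \<int> \<times> \<int>) \<union>
                        ((\<lambda>x. 1 / sqrt 3 * x) ` half_integers \<times> half_integers \<times> half_integers \<times>
                           half_integers \<times> half_integers \<times> half_integers).
                      star_condition (p ^ i) b}) \<and>
         (p \<noteq> 3 \<longrightarrow>
            N L \<Phi> \<Delta> m p =
              card {b \<in> ((\<lambda>x. sqrt 3 * x) ` \<int> \<times> \<int> \<times> \<int> \<times> \<int> \<times> \<int> \<times> \<int>) \<union>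
                        ((\<lambda>x. sqrt 3 * x) ` half_integers \<times> half_integers \<times> half_integers \<times>
                           half_integers \<times> half_integers \<times> half_integers).
                      star_condition (p ^ i) b})"
proof -
  have rs: "root_system \<Phi>"
    using assms(1) by (simp add: simply_connected_datum_def root_datum_def)
  obtain a :: "nat \<Rightarrow> 'a" where \<Delta>: "\<Delta> = a ` {1..6}"
    and gram: "\<And>i j. i \<in> {1..6} \<Longrightarrow> j \<in> {1..6} \<Longrightarrow>
      a i \<bullet> a j = (if i = j then 2 else if {i, j} \<in> E6_edges then -1 else 0)"
    and norm: "\<And>\<alpha>. \<alpha> \<in> \<Phi> \<Longrightarrow> \<alpha> \<bullet> \<alpha> = 2"
    using type_E6_gram[OF rs assms(2-4)] by blast
  have "{1..6} = {1, 2, 3, 4, 5, 6 :: nat}" by auto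
  then have \<Delta>_eq: "\<Delta> = {a 1, a 2, a 3, a 4, a 5, a 6}" unfolding \<Delta> by simp
  interpret e6_root_datum L \<Phi> "a 1" "a 2" "a 3" "a 4" "a 5" "a 6"
  proof unfold_locales
    show "root_system \<Phi>" by (rule rs)
    show "root_base \<Phi> {a 1, a 2, a 3, a 4, a 5, a 6}" using assms(2) unfolding \<Delta>_eq .
    show "\<alpha> \<bullet> \<alpha> = 2" if "\<alpha> \<in> \<Phi>" for \<alpha> by (rule norm[OF that])
    show "x \<in> L \<longleftrightarrow> (\<forall>\<delta>\<in>{a 1, a 2, a 3, a 4, a 5, a 6}. x \<bullet> \<delta> \<in> \<int>)" for x
      using mem_weight_lattice_iff[OF assms(1,2) norm] unfolding \<Delta>_eq .
  qed (simp_all add: gram E6_edges_def doubleton_eq_iff)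
  have "m' > 0" using assms(5,7) by (cases m') auto
  from N_eq_card_e6_points[OF assms(6) this assms(8)]
  have N_eq: "N L \<Phi> \<Delta> m p = card (e6_points (p ^ i) (if p = 3 then 1 else 3))"
    unfolding \<Delta>_eq assms(7) .
  have tuples: "card {b \<in> e6_tuples (if p = 3 then 1 else 3). star_condition (p ^ i) b} = N L \<Phi> \<Delta> m p"
    unfolding N_eq by (rule card_e6_tuples) simp
  show ?thesis
    using tuples e6_tuples_eq[of "1 / sqrt 3" 1] e6_tuples_eq[of "sqrt 3" 3] by (cases "p = 3") simp_all
qed

end
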